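(* Let $J=[0,\rho]$, let $\sigma,\tau,\eta:J\to J$, $q\in C(J)$, $f:J\times\mathbb R\to\mathbb R$ and $K:J\times J\times\mathbb R\to\mathbb R$. Assume: (i) the partial mappings $t\mapsto f(t,x)$ and $(t,s)\mapsto K(t,s,x)$ are continuous; (ii) there exist $r>0$ and two nondecreasing, continuous functions $\varphi,\psi:\mathbb R_+\to\mathbb R_+$ such that $$|f(t,x)-f(t,y)|\le\alpha(t)\,\varphi(|x-y|),\quad t\in J,\ x,y\in\mathbb R\text{ with }|x|,|y|\le r,$$ and $$|K(t,s,x)-K(t,s,y)|\le\gamma(t,s)\,\psi(|x-y|),\quad t,s\in J,\ x,y\in\mathbb R\text{ with }|x|,|y|\le r.$$ Put $$M_F=\|\alpha\|_\infty\varphi(r)+\|f(\cdot,0)\|_\infty,\qquad M_G=\|q\|_\infty+\rho\big(\|K(\cdot,\cdot,0)\|_\infty+\|\gamma\|_\infty\psi(r)\big).$$ If $$M_F\,\rho\,\|\gamma\|_\infty\psi(t)+M_G\|\alpha\|_\infty\varphi(t)<t\quad\text{for all }t>0,$$ and $$M_FM_G\le r,$$ then the nonlinear integral equation $$x(t)=f(t,x(\sigma(t)))\cdot\left[q(t)+\int_0^{\eta(t)}K(t,s,x(\tau(s)))\,ds\right],\quad t\in J,$$ has a unique solution in $B_r$.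
   Context: $\rho>0$. $C(J)$ is the space of all continuous functions from $J$ into $\mathbb R$ with the norm $\|x\|_\infty=\sup_{t\in J}|x(t)|$, and $B_r=\{x\in C(J):\|x\|_\infty\le r\}$. In (ii), $\alpha$ is a nonnegative bounded function on $J$ and $\gamma$ is a nonnegative bounded function on $J\times J$. The symbol $\|\cdot\|_\infty$ applied to a function on $J$ or on $J\times J$ denotes the supremum of its absolute value.
   Formalization: The maps σ and η are additionally assumed continuous on J and τ Lebesgue measurable on J; for arbitrary maps J→J the claim fails (e.g. f=1, q=0, K=1 gives x=η, which is not in C(J) for discontinuous η). *)

theory Defs
  imports "HOL-Analysis.Analysis"
begin

definition sup_norm_on :: "'a set \<Rightarrow> ('a \<Rightarrow> real) \<Rightarrow> real" where
  "sup_norm_on S g = (SUP s\<in>S. \<bar>g s\<bar>)"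

text \<open>Membership in \<^term>\<open>extensional J\<close> makes equality of elements mean equality as functions
  on \<open>J\<close>, so that uniqueness can be expressed by \<open>\<exists>!\<close>.\<close>

definition C_space :: "real set \<Rightarrow> (real \<Rightarrow> real) set" where
  "C_space J = {x \<in> extensional J. continuous_on J x}"

definition C_ball :: "real set \<Rightarrow> real \<Rightarrow> (real \<Rightarrow> real) set" where
  "C_ball J r = {x \<in> C_space J. sup_norm_on J x \<le> r}"

text \<open>Integrability is part of being a solution, because \<^const>\<open>integral\<close> has the default value
  \<open>0\<close> on functions that are not integrable.\<close>

definition solves_integral_eq ::
  "real set \<Rightarrow> (real \<Rightarrow> real \<Rightarrow> real) \<Rightarrow> (real \<Rightarrow> real \<Rightarrow> real \<Rightarrow> real) \<Rightarrow> (real \<Rightarrow> real)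
    \<Rightarrow> (real \<Rightarrow> real) \<Rightarrow> (real \<Rightarrow> real) \<Rightarrow> (real \<Rightarrow> real) \<Rightarrow> (real \<Rightarrow> real) \<Rightarrow> bool" where
  "solves_integral_eq J f K q \<sigma> \<tau> \<eta> x \<longleftrightarrow>
    (\<forall>t\<in>J. (\<lambda>s. K t s (x (\<tau> s))) integrable_on {0..\<eta> t} \<and>
       x t = f t (x (\<sigma> t)) * (q t + integral {0..\<eta> t} (\<lambda>s. K t s (x (\<tau> s)))))"

end

theory Submission imports Defs begin

text \<open>
  Write the right-hand side as a product \<open>T x = F x \<cdot> G x\<close>, where \<open>F x\<close> is the superposition factor
  \<open>f t (x (\<sigma> t))\<close> and \<open>G x\<close> the bracket with the integral. On the ball of radius \<open>r\<close> the growth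
  conditions give \<open>\<bar>F x\<bar> \<le> M_F\<close> and \<open>\<bar>G x\<bar> \<le> M_G\<close>, so \<open>M_F * M_G \<le> r\<close> makes \<open>T\<close> a self-map of the
  ball, and splitting \<open>T x - T y = F x * (G x - G y) + G y * (F x - F y)\<close> gives
  \<open>\<parallel>T x - T y\<parallel> \<le> \<Phi> \<parallel>x - y\<parallel>\<close> for the nondecreasing continuous function
  \<open>\<Phi> t = M_F * \<rho> * \<parallel>\<gamma>\<parallel> * \<psi> t + M_G * \<parallel>\<alpha>\<parallel> * \<phi> t\<close>. Since \<open>\<Phi> t < t\<close>, the fixed point theorem of Boyd
  and Wong applies in the complete space of continuous functions
  (\<open>nonlinear_contraction_fixed_point\<close>, \<open>nonlinear_contraction_on_C_ball\<close>).

  The delicate point is that \<open>T x\<close> must be well defined and continuous. A modulus of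
  continuity in the last argument that vanishes at \<open>0\<close> turns separate continuity of \<open>f\<close> and \<open>K\<close> into
  joint continuity (\<open>continuous_on_Times_modulus\<close>); from this follow integrability of
  \<open>K t s (x (\<tau> s))\<close> for a merely measurable \<open>\<tau>\<close> (\<open>integrable_on_superposition\<close>) and continuity of
  the integral in \<open>t\<close> (\<open>continuous_on_integral_moving_endpoint\<close>).

  The moduli \<open>\<parallel>\<alpha>\<parallel> * \<phi>\<close> and \<open>\<parallel>\<gamma>\<parallel> * \<psi>\<close> do vanish at \<open>0\<close> if both \<open>M_F\<close> and \<open>M_G\<close> are positive,
  because \<open>\<Phi> t < t\<close> forces \<open>\<Phi> 0 = 0\<close>. If one of these constants is \<open>0\<close>, then \<open>f\<close> or \<open>K\<close> may be
  discontinuous in its last argument and \<open>T x\<close> need not be defined for all \<open>x\<close>; but then the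
  right-hand side is \<open>0\<close> wherever it is defined, and the zero function is the only solution
  (\<open>ex1_solution_of_zero_bound\<close>).
\<close>

section \<open>Nonlinear contractions\<close>

text \<open>The theorem of Boyd and Wong for a nondecreasing comparison function. The distances of successive
  iterates decrease to a limit \<open>c\<close> with \<open>c \<le> \<Phi> c\<close>, hence to \<open>0\<close>. Once such a distance is below
  \<open>h - \<Phi> h\<close>, the ball of radius \<open>h\<close> around the current iterate is mapped into itself, which
  replaces the geometric series of the Banach theorem in proving the Cauchy property.\<close>

lemma nonlinear_contraction_fixed_point:
  fixes T :: "'a::metric_space \<Rightarrow> 'a" and \<Phi> :: "real \<Rightarrow> real"
  assumes "complete S" and "S \<noteq> {}" and T: "T \<in> S \<rightarrow> S"
    and mono: "mono_on {0..} \<Phi>" and cont: "continuous_on {0..} \<Phi>"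
    and less: "\<And>t. t > 0 \<Longrightarrow> \<Phi> t < t" and zero: "\<Phi> 0 = 0"
    and contr: "\<And>x y. x \<in> S \<Longrightarrow> y \<in> S \<Longrightarrow> dist (T x) (T y) \<le> \<Phi> (dist x y)"
  shows "\<exists>!x. x \<in> S \<and> T x = x"
proof -
  have \<Phi>_le: "\<Phi> t \<le> t" if "t \<ge> 0" for t
    using less[of t] zero that by (cases "t = 0") auto
  obtain x0 where "x0 \<in> S" using \<open>S \<noteq> {}\<close> by blast
  define x where "x n = (T ^^ n) x0" for n
  have x_Suc: "x (Suc n) = T (x n)" for n by (simp add: x_def)
  have xS: "x n \<in> S" for n
    using T \<open>x0 \<in> S\<close> by (induction n) (auto simp: x_def)
  define d where "d n = dist (x n) (x (Suc n))" for n
  have d_Suc: "d (Suc n) \<le> \<Phi> (d n)" for n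
    using contr[OF xS xS, of n "Suc n"] by (simp add: d_def x_Suc)
  have d_nonneg: "d n \<ge> 0" for n by (simp add: d_def)
  have "decseq d"
    by (rule decseq_SucI) (rule order_trans[OF d_Suc \<Phi>_le[OF d_nonneg]])
  then obtain c where c: "d \<longlonglongrightarrow> c"
    using decseq_convergent[of d 0] d_nonneg by blast
  have "c \<ge> 0" using LIMSEQ_le_const[OF c] d_nonneg by blast
  have "(\<lambda>n. \<Phi> (d n)) \<longlonglongrightarrow> \<Phi> c"
    using continuous_on_tendsto_compose[OF cont c] \<open>c \<ge> 0\<close> d_nonneg by simp
  moreover have "(\<lambda>n. d (Suc n)) \<longlonglongrightarrow> c" using c by (rule LIMSEQ_Suc)
  ultimately have "c \<le> \<Phi> c" using d_Suc by (intro LIMSEQ_le) auto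
  with less[of c] \<open>c \<ge> 0\<close> have "c = 0" by fastforce
  with c have d0: "d \<longlonglongrightarrow> 0" by simp
  have "Cauchy x"
    unfolding Cauchy_altdef2
  proof (intro allI impI)
    fix e :: real assume "e > 0"
    define h where "h = e / 2"
    have "h > 0" "h < e" using \<open>e > 0\<close> by (auto simp: h_def)
    then have "eventually (\<lambda>n. d n < h - \<Phi> h) sequentially"
      using order_tendstoD(2)[OF d0] less[of h] by simp
    then obtain N where N: "d N < h - \<Phi> h" by (auto simp: eventually_sequentially)
    \<comment> \<open>The choice of \<open>N\<close> makes \<open>\<Phi> h + d N < h\<close>, so the iterates cannot leave the ball of radius \<open>h\<close>.\<close>
    have "dist (x n) (x N) \<le> h" if "n \<ge> N" for n
      using that
    proof (induction n rule: dec_induct)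
      case base then show ?case using \<open>h > 0\<close> by simp
    next
      case (step n)
      have "dist (x (Suc n)) (x N) \<le> dist (T (x n)) (T (x N)) + d N"
        using dist_triangle[of "x (Suc n)" "x N" "x (Suc N)"]
        by (simp add: x_Suc d_def dist_commute)
      also have "dist (T (x n)) (T (x N)) \<le> \<Phi> h"
        using contr[OF xS xS] mono_onD[OF mono, of "dist (x n) (x N)" h] step \<open>h > 0\<close>
        by (smt (verit, best) atLeast_iff zero_le_dist)
      finally show ?case using N by simp
    qed
    with \<open>h < e\<close> show "\<exists>N. \<forall>n\<ge>N. dist (x n) (x N) < e" by (meson le_less_trans)
  qed
  then obtain l where "l \<in> S" and l: "x \<longlonglongrightarrow> l"
    using \<open>complete S\<close> xS unfolding complete_def by blast
  have "(\<lambda>n. dist (x n) l) \<longlonglongrightarrow> 0" using l by (rule tendsto_dist_iff[THEN iffD1])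
  then have "(\<lambda>n. dist (x (Suc n)) (T l)) \<longlonglongrightarrow> 0"
  proof (rule Lim_null_comparison[rotated], intro always_eventually allI)
    fix n
    show "norm (dist (x (Suc n)) (T l)) \<le> dist (x n) l"
      using contr[OF xS \<open>l \<in> S\<close>, of n] \<Phi>_le[of "dist (x n) l"] by (simp add: x_Suc)
  qed
  then have "(\<lambda>n. x (Suc n)) \<longlonglongrightarrow> T l" by (rule tendsto_dist_iff[THEN iffD2])
  then have "T l = l" using LIMSEQ_Suc[OF l] LIMSEQ_unique by blast
  show ?thesis
  proof (rule ex1I[of _ l])
    fix y assume y: "y \<in> S \<and> T y = y"
    show "y = l"
      using contr[of y l] less[of "dist y l"] y \<open>l \<in> S\<close> \<open>T l = l\<close> by fastforce
  qed (use \<open>l \<in> S\<close> \<open>T l = l\<close> in simp)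
qed

section \<open>Fixed points in balls of continuous functions\<close>

lemma abs_le_sup_norm_on:
  "bounded (g ` S) \<Longrightarrow> s \<in> S \<Longrightarrow> \<bar>g s\<bar> \<le> sup_norm_on S g"
  unfolding sup_norm_on_def
  by (rule cSUP_upper)
    (auto simp: bounded_iff intro: bdd_aboveI2[of S "\<lambda>s. \<bar>g s\<bar>"])

lemma mem_C_ball_iff:
  assumes "compact J" "J \<noteq> {}"
  shows "x \<in> C_ball J r \<longleftrightarrow> x \<in> extensional J \<and> continuous_on J x \<and> (\<forall>t\<in>J. \<bar>x t\<bar> \<le> r)"
proof -
  have "sup_norm_on J x \<le> r \<longleftrightarrow> (\<forall>t\<in>J. \<bar>x t\<bar> \<le> r)" if "continuous_on J x"
  proof
    assume "sup_norm_on J x \<le> r"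
    then show "\<forall>t\<in>J. \<bar>x t\<bar> \<le> r"
      using abs_le_sup_norm_on[of x J] compact_imp_bounded[OF compact_continuous_image[OF that]]
        assms by fastforce
  next
    assume "\<forall>t\<in>J. \<bar>x t\<bar> \<le> r"
    then show "sup_norm_on J x \<le> r"
      unfolding sup_norm_on_def using \<open>J \<noteq> {}\<close> by (intro cSUP_least) auto
  qed
  then show ?thesis by (auto simp: C_ball_def C_space_def)
qed

text \<open>The ball is identified with a ball of the complete space of bounded continuous functions on the
  whole line: \<open>E\<close> extends a function from \<open>{a..b}\<close> by its boundary values, and the operator
  \<open>g \<mapsto> E (T g)\<close> is a contraction of the full ball around \<open>0\<close>. The contraction hypothesis
  quantifies over all pointwise bounds \<open>D\<close> on \<open>J\<close>; for \<open>D = 0\<close> it says that \<open>T x\<close> depends on \<open>J\<close> only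
  on the values of \<open>x\<close> there, so that extending and restricting do not disturb the fixed point
  equation.\<close>

lemma nonlinear_contraction_on_C_ball:
  fixes T :: "(real \<Rightarrow> real) \<Rightarrow> real \<Rightarrow> real" and \<Phi> :: "real \<Rightarrow> real"
  assumes "a \<le> b" and J: "J = {a..b}" and "r \<ge> 0"
    and mono: "mono_on {0..} \<Phi>" and cont: "continuous_on {0..} \<Phi>"
    and less: "\<And>t. t > 0 \<Longrightarrow> \<Phi> t < t" and zero: "\<Phi> 0 = 0"
    and T_cont: "\<And>x. continuous_on J x \<Longrightarrow> (\<And>t. t \<in> J \<Longrightarrow> \<bar>x t\<bar> \<le> r) \<Longrightarrow> continuous_on J (T x)"
    and T_bound: "\<And>x t. continuous_on J x \<Longrightarrow> (\<And>t. t \<in> J \<Longrightarrow> \<bar>x t\<bar> \<le> r) \<Longrightarrow> t \<in> J \<Longrightarrow> \<bar>T x t\<bar> \<le> r"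
    and contr: "\<And>x y D t. continuous_on J x \<Longrightarrow> (\<And>t. t \<in> J \<Longrightarrow> \<bar>x t\<bar> \<le> r) \<Longrightarrow>
      continuous_on J y \<Longrightarrow> (\<And>t. t \<in> J \<Longrightarrow> \<bar>y t\<bar> \<le> r) \<Longrightarrow>
      (\<And>t. t \<in> J \<Longrightarrow> \<bar>x t - y t\<bar> \<le> D) \<Longrightarrow> t \<in> J \<Longrightarrow> \<bar>T x t - T y t\<bar> \<le> \<Phi> D"
  shows "\<exists>!x. x \<in> C_ball J r \<and> (\<forall>t\<in>J. x t = T x t)"
proof -
  have J': "compact J" "J \<noteq> {}" "J = cbox a b" using J \<open>a \<le> b\<close> by auto
  have clampJ: "clamp a b t \<in> J" for t using J' clamp_in_interval[of a b t] \<open>a \<le> b\<close> by auto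
  have clamp_id: "clamp a b t = t" if "t \<in> J" for t using that J' by simp
  define E where "E x = Bcontfun (\<lambda>t. x (clamp a b t))" for x :: "real \<Rightarrow> real"
  have E: "apply_bcontfun (E x) t = x (clamp a b t)" if x: "continuous_on J x" for x t
  proof -
    obtain g :: "real \<Rightarrow>\<^sub>C real" where "\<And>t. g t = x (clamp a b t)"
      using continuous_on_cbox_bcontfunE[of a b x] x J' by metis
    then have "apply_bcontfun g = (\<lambda>t. x (clamp a b t))" by auto
    then have "E x = g" by (metis E_def apply_bcontfun_inverse)
    then show ?thesis by (simp add: \<open>\<And>t. g t = x (clamp a b t)\<close>)
  qed
  let ?S = "cball 0 r :: (real \<Rightarrow>\<^sub>C real) set"
  define U where "U g = E (T (apply_bcontfun g))" for g :: "real \<Rightarrow>\<^sub>C real"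
  have ball: "\<bar>apply_bcontfun g t\<bar> \<le> r" if "g \<in> ?S" for g t
    using norm_bounded[of g t] that by simp
  have U: "apply_bcontfun (U g) t = T g (clamp a b t)" if "g \<in> ?S" for g t
    unfolding U_def by (rule E[OF T_cont]) (use ball[OF that] in auto)
  have "\<exists>!g. g \<in> ?S \<and> U g = g"
  proof (rule nonlinear_contraction_fixed_point[OF _ _ _ mono cont less zero])
    show "complete ?S" by (simp add: complete_eq_closed)
    show "?S \<noteq> {}" using \<open>r \<ge> 0\<close> by simp
    show "U \<in> ?S \<rightarrow> ?S"
    proof
      fix g assume g: "g \<in> ?S"
      have "norm (U g) \<le> r"
        using T_bound[of g] ball[OF g] clampJ by (intro norm_bound) (auto simp: U[OF g])
      then show "U g \<in> ?S" by simp
    qed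
    fix g h assume gh: "g \<in> ?S" "h \<in> ?S"
    show "dist (U g) (U h) \<le> \<Phi> (dist g h)"
    proof (rule dist_bound)
      fix t
      show "dist (U g t) (U h t) \<le> \<Phi> (dist g h)"
        using contr[of g h "dist g h" "clamp a b t"] ball gh clampJ dist_bounded[of g _ h]
        by (auto simp: U[OF gh(1)] U[OF gh(2)] dist_real_def)
    qed
  qed
  then obtain g where g: "g \<in> ?S" "U g = g" and uniq: "\<And>h. h \<in> ?S \<Longrightarrow> U h = h \<Longrightarrow> h = g"
    by blast
  have T_cong: "T x t = T y t" if "continuous_on J x" "\<And>t. t \<in> J \<Longrightarrow> \<bar>x t\<bar> \<le> r"
    "\<And>t. t \<in> J \<Longrightarrow> x t = y t" "t \<in> J" for x y t
  proof -
    have "continuous_on J y" using that(1,3) continuous_on_cong by metis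
    then show ?thesis using contr[of x y 0 t] that zero by auto
  qed
  show ?thesis
  proof (rule ex1I[of _ "restrict g J"])
    have "T (restrict g J) t = g t" if "t \<in> J" for t
    proof -
      have "g t = T g t" using U[OF g(1), of t] g(2) clamp_id[OF that] by simp
      moreover have "T g t = T (restrict g J) t"
        using ball[OF g(1)] that by (intro T_cong) auto
      ultimately show ?thesis by simp
    qed
    moreover have "continuous_on J (restrict g J)"
      using continuous_on_apply_bcontfun[of J g] by (simp cong: continuous_on_cong)
    ultimately show "restrict g J \<in> C_ball J r \<and> (\<forall>t\<in>J. restrict g J t = T (restrict g J) t)"
      using ball[OF g(1)] by (simp add: mem_C_ball_iff J'(1,2))
  next
    fix x assume x: "x \<in> C_ball J r \<and> (\<forall>t\<in>J. x t = T x t)"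
    then have xc: "continuous_on J x" and xr: "\<And>t. t \<in> J \<Longrightarrow> \<bar>x t\<bar> \<le> r" and xe: "x \<in> extensional J"
      by (auto simp: mem_C_ball_iff J'(1,2))
    have "norm (E x) \<le> r"
      using clampJ xr by (intro norm_bound) (auto simp: E[OF xc])
    then have ES: "E x \<in> ?S" by simp
    moreover have "U (E x) = E x"
    proof (rule bcontfun_eqI)
      fix t
      have "T x (clamp a b t) = T (E x) (clamp a b t)"
        by (rule T_cong) (auto simp: E[OF xc] xc xr clampJ clamp_id)
      then show "U (E x) t = E x t"
        using x clampJ by (simp add: U[OF ES] E[OF xc])
    qed
    ultimately have "E x = g" by (rule uniq)
    then show "x = restrict g J"
      using E[OF xc] clamp_id xe by (intro extensionalityI[of _ J]) auto
  qed
qed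

section \<open>Superposition and integration\<close>

text \<open>Near \<open>(a, y)\<close> the distance of \<open>g a' y'\<close> from \<open>g a y\<close> is at most
  \<open>\<omega> (dist y' y) + dist (g a' y) (g a y)\<close>: a modulus in \<open>y\<close> that is uniform in \<open>a\<close> upgrades
  separate to joint continuity.\<close>

lemma continuous_on_Times_modulus:
  fixes g :: "'a::metric_space \<Rightarrow> 'b::metric_space \<Rightarrow> 'c::metric_space" and \<omega> :: "real \<Rightarrow> real"
  assumes sect: "\<And>y. y \<in> Y \<Longrightarrow> continuous_on A (\<lambda>a. g a y)"
    and \<omega>: "continuous_on {0..} \<omega>" "\<omega> 0 = 0"
    and mod: "\<And>a y z. a \<in> A \<Longrightarrow> y \<in> Y \<Longrightarrow> z \<in> Y \<Longrightarrow> dist (g a y) (g a z) \<le> \<omega> (dist y z)"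
  shows "continuous_on (A \<times> Y) (\<lambda>(a, y). g a y)"
proof (clarsimp simp: continuous_on_def)
  fix a y assume "a \<in> A" "y \<in> Y"
  let ?F = "at (a, y) within A \<times> Y"
  have fst: "((\<lambda>p. fst p) \<longlongrightarrow> a) ?F" and snd: "((\<lambda>p. snd p) \<longlongrightarrow> y) ?F"
    using tendsto_fst[OF tendsto_ident_at[of "(a, y)" "A \<times> Y"]]
      tendsto_snd[OF tendsto_ident_at[of "(a, y)" "A \<times> Y"]]
    unfolding fst_conv snd_conv by blast+
  have inA: "eventually (\<lambda>p. p \<in> A \<times> Y) ?F" by (simp add: eventually_at_filter)
  have "((\<lambda>p. dist (snd p) y) \<longlongrightarrow> 0) ?F"
    using snd by (rule tendsto_dist_iff[THEN iffD1])
  then have "((\<lambda>p. \<omega> (dist (snd p) y)) \<longlongrightarrow> \<omega> 0) ?F"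
    by (rule continuous_on_tendsto_compose[OF \<omega>(1)]) auto
  moreover have "((\<lambda>p. g (fst p) y) \<longlongrightarrow> g a y) ?F"
    using inA by (intro continuous_on_tendsto_compose[OF sect[OF \<open>y \<in> Y\<close>] fst \<open>a \<in> A\<close>])
      (auto elim: eventually_mono)
  then have "((\<lambda>p. dist (g (fst p) y) (g a y)) \<longlongrightarrow> 0) ?F"
    by (rule tendsto_dist_iff[THEN iffD1])
  ultimately have "((\<lambda>p. \<omega> (dist (snd p) y) + dist (g (fst p) y) (g a y)) \<longlongrightarrow> 0) ?F"
    using tendsto_add[of _ 0 _ _ 0] \<omega>(2) by fastforce
  moreover have "eventually (\<lambda>p. norm (dist (g (fst p) (snd p)) (g a y)) \<le>
      \<omega> (dist (snd p) y) + dist (g (fst p) y) (g a y)) ?F"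
    using inA
  proof eventually_elim
    case (elim p)
    then show ?case
      using mod[of "fst p" "snd p" y] \<open>y \<in> Y\<close>
        dist_triangle[of "g (fst p) (snd p)" "g a y" "g (fst p) y"] by auto
  qed
  ultimately have "((\<lambda>p. dist (g (fst p) (snd p)) (g a y)) \<longlongrightarrow> 0) ?F"
    by (rule Lim_null_comparison[rotated])
  then show "((\<lambda>(a, y). g a y) \<longlongrightarrow> g a y) ?F"
    unfolding case_prod_unfold by (rule tendsto_dist_iff[THEN iffD2])
qed

text \<open>The pair \<open>(s, u s)\<close> is Lebesgue measurable and stays in the compact set on which \<open>h\<close> is continuous,
  so that the integrand is measurable and bounded.\<close>

lemma integrable_on_superposition:
  fixes h :: "real \<Rightarrow> real \<Rightarrow> real"
  assumes h: "continuous_on ({a..b} \<times> Y) (\<lambda>(s, y). h s y)" and "compact Y"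
    and u: "u \<in> borel_measurable (lebesgue_on {a..b})" "u \<in> {a..b} \<rightarrow> Y"
  shows "(\<lambda>s. h s (u s)) integrable_on {a..b}"
proof -
  interpret finite_measure "lebesgue_on {a..b}" by (rule finite_measure_lebesgue_on) simp
  have "compact ((\<lambda>(s, y). h s y) ` ({a..b} \<times> Y))"
    using h \<open>compact Y\<close> by (intro compact_continuous_image compact_Times) auto
  then obtain C where C: "\<And>s y. s \<in> {a..b} \<Longrightarrow> y \<in> Y \<Longrightarrow> \<bar>h s y\<bar> \<le> C"
    using bounded_iff[THEN iffD1, OF compact_imp_bounded] by fastforce
  have id: "(\<lambda>s. s) \<in> borel_measurable (lebesgue_on {a..b})"
    by (intro borel_measurable_continuous_onI measurable_restrict_space1 measurable_completion) auto
  have "(\<lambda>s. (s, u s)) \<in> borel_measurable (lebesgue_on {a..b})"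
    using id u(1) by simp
  then have "(\<lambda>s. (s, u s)) \<in> measurable (lebesgue_on {a..b}) (restrict_space borel ({a..b} \<times> Y))"
    using u(2) by (intro measurable_restrict_space2) auto
  from measurable_compose[OF this borel_measurable_continuous_on_restrict[OF h]]
  have "(\<lambda>s. h s (u s)) \<in> borel_measurable (lebesgue_on {a..b})" by simp
  then have "integrable (lebesgue_on {a..b}) (\<lambda>s. h s (u s))"
    by (rule integrable_const_bound[rotated, of _ C]) (use C u(2) in \<open>auto intro!: AE_I2 simp: Pi_iff\<close>)
  then show ?thesis by (intro integrable_on_lebesgue_on) auto
qed

lemma abs_integral_le:
  fixes g :: "real \<Rightarrow> real"
  assumes "g integrable_on {a..b}" and "a \<le> b" and "\<And>s. s \<in> {a..b} \<Longrightarrow> \<bar>g s\<bar> \<le> C"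
  shows "\<bar>integral {a..b} g\<bar> \<le> (b - a) * C"
proof -
  have "norm (integral {a..b} g) \<le> integral {a..b} (\<lambda>_. C)"
    using assms by (intro Henstock_Kurzweil_Integration.integral_norm_bound_integral) auto
  with \<open>a \<le> b\<close> show ?thesis by simp
qed

text \<open>The integral over \<open>{a..u}\<close> of \<open>g t\<close> is continuous in \<open>t\<close> for fixed \<open>u\<close> by dominated convergence, and
  Lipschitz in \<open>u\<close> with constant \<open>C\<close> for every \<open>t\<close>. Hence it is jointly continuous in \<open>(t, u)\<close>, and the
  endpoint may move continuously with \<open>t\<close>.\<close>

lemma continuous_on_integral_moving_endpoint:
  fixes g :: "'a::metric_space \<Rightarrow> real \<Rightarrow> real"
  assumes int: "\<And>t. t \<in> A \<Longrightarrow> g t integrable_on {a..b}"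
    and sect: "\<And>s. s \<in> {a..b} \<Longrightarrow> continuous_on A (\<lambda>t. g t s)"
    and bound: "\<And>t s. t \<in> A \<Longrightarrow> s \<in> {a..b} \<Longrightarrow> \<bar>g t s\<bar> \<le> C"
    and \<eta>: "continuous_on A \<eta>" "\<eta> \<in> A \<rightarrow> {a..b}"
  shows "continuous_on A (\<lambda>t. integral {a..\<eta> t} (g t))"
proof -
  have sub: "g t integrable_on {c..d}" if "t \<in> A" "a \<le> c" "d \<le> b" for t c d
    by (rule integrable_on_subinterval[OF int]) (use that in auto)
  have "continuous_on (A \<times> {a..b}) (\<lambda>(t, u). integral {a..u} (g t))"
  proof (rule continuous_on_Times_modulus[where \<omega> = "\<lambda>d. C * d"])
    fix u assume u: "u \<in> {a..b}"
    show "continuous_on A (\<lambda>t. integral {a..u} (g t))"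
      unfolding continuous_on_sequentially comp_def
    proof (intro allI ballI impI, elim conjE)
      fix T t assume t: "t \<in> A" and T: "\<forall>n. T n \<in> A" "T \<longlonglongrightarrow> t"
      show "(\<lambda>n. integral {a..u} (g (T n))) \<longlonglongrightarrow> integral {a..u} (g t)"
      proof (rule dominated_convergence(2)[where h = "\<lambda>_. C"])
        fix s assume "s \<in> {a..u}"
        then show "(\<lambda>n. g (T n) s) \<longlonglongrightarrow> g t s"
          using continuous_on_tendsto_compose[OF sect T(2) t] T(1) u by simp
      qed (use T u in \<open>auto intro!: sub bound\<close>)
    qed
  next
    fix t u v assume t: "t \<in> A" and "u \<in> {a..b}" "v \<in> {a..b}"
    have le: "\<bar>integral {a..v} (g t) - integral {a..u} (g t)\<bar> \<le> C * (v - u)"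
      if "u \<le> v" "u \<in> {a..b}" "v \<in> {a..b}" for u v
    proof -
      have "integral {a..u} (g t) + integral {u..v} (g t) = integral {a..v} (g t)"
        by (rule Henstock_Kurzweil_Integration.integral_combine) (use that t in \<open>auto intro: sub\<close>)
      moreover have "\<bar>integral {u..v} (g t)\<bar> \<le> (v - u) * C"
        using that t by (intro abs_integral_le sub bound) auto
      ultimately show ?thesis using that by (simp add: algebra_simps)
    qed
    show "dist (integral {a..u} (g t)) (integral {a..v} (g t)) \<le> C * dist u v"
      using le[of u v] le[of v u] \<open>u \<in> {a..b}\<close> \<open>v \<in> {a..b}\<close>
      by (cases "u \<le> v") (auto simp: dist_real_def abs_minus_commute)
  qed (auto intro!: continuous_intros)
  moreover have "continuous_on A (\<lambda>t. (t, \<eta> t))" using \<eta> by (auto intro!: continuous_intros)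
  ultimately show ?thesis
    using continuous_on_compose2[of "A \<times> {a..b}" "\<lambda>(t, u). integral {a..u} (g t)" A "\<lambda>t. (t, \<eta> t)"] \<eta>(2)
    by (simp add: image_subset_iff Pi_iff)
qed

section \<open>The integral equation with bounded data\<close>

text \<open>Common ground of the degenerate and the contractive case: in the degenerate case \<open>f\<close> or \<open>K\<close> may be
  discontinuous in its last argument, so a modulus of continuity enters only in the extension of
  this locale.\<close>

locale product_integral_equation =
  fixes \<rho> r M_F Q C :: real
    and J :: "real set"
    and \<sigma> \<tau> \<eta> q :: "real \<Rightarrow> real"
    and f :: "real \<Rightarrow> real \<Rightarrow> real"
    and K :: "real \<Rightarrow> real \<Rightarrow> real \<Rightarrow> real"
  assumes \<rho>_nonneg: "\<rho> \<ge> 0" and J: "J = {0..\<rho>}" and r_nonneg: "r \<ge> 0"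
    and \<sigma>: "\<sigma> \<in> J \<rightarrow> J" "continuous_on J \<sigma>"
    and \<tau>: "\<tau> \<in> J \<rightarrow> J" "\<tau> \<in> borel_measurable (lebesgue_on J)"
    and \<eta>: "\<eta> \<in> J \<rightarrow> J" "continuous_on J \<eta>"
    and q: "continuous_on J q" "\<And>t. t \<in> J \<Longrightarrow> \<bar>q t\<bar> \<le> Q"
    and f_cont: "\<And>x. \<bar>x\<bar> \<le> r \<Longrightarrow> continuous_on J (\<lambda>t. f t x)"
    and K_cont: "\<And>x. \<bar>x\<bar> \<le> r \<Longrightarrow> continuous_on (J \<times> J) (\<lambda>(t, s). K t s x)"
    and f_bound: "\<And>t x. t \<in> J \<Longrightarrow> \<bar>x\<bar> \<le> r \<Longrightarrow> \<bar>f t x\<bar> \<le> M_F"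
    and K_bound: "\<And>t s x. t \<in> J \<Longrightarrow> s \<in> J \<Longrightarrow> \<bar>x\<bar> \<le> r \<Longrightarrow> \<bar>K t s x\<bar> \<le> C"
begin

definition integral_factor :: "(real \<Rightarrow> real) \<Rightarrow> real \<Rightarrow> real" where
  "integral_factor x t = q t + integral {0..\<eta> t} (\<lambda>s. K t s (x (\<tau> s)))"

definition product_op :: "(real \<Rightarrow> real) \<Rightarrow> real \<Rightarrow> real" where
  "product_op x t = f t (x (\<sigma> t)) * integral_factor x t"

lemma zero_mem: "0 \<in> J"
  using J \<rho>_nonneg by simp

lemma M_F_nonneg: "M_F \<ge> 0"
  using f_bound[OF zero_mem, of 0] r_nonneg by force

lemma C_nonneg: "C \<ge> 0"
  using K_bound[OF zero_mem zero_mem, of 0] r_nonneg by force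

lemma Q_nonneg: "Q \<ge> 0"
  using q(2)[OF zero_mem] by force

lemma \<eta>_le: "t \<in> J \<Longrightarrow> 0 \<le> \<eta> t \<and> \<eta> t \<le> \<rho>"
  using \<eta>(1) J by auto

lemma mem_C_ball: "x \<in> C_ball J r \<longleftrightarrow>
    x \<in> extensional J \<and> continuous_on J x \<and> (\<forall>t\<in>J. \<bar>x t\<bar> \<le> r)"
  using J \<rho>_nonneg by (intro mem_C_ball_iff) auto

text \<open>Integrability is a hypothesis in the next two lemmas because they are also applied where \<open>K\<close> may be
  discontinuous in its last argument; there it is known only for a given solution.\<close>

lemma integral_factor_bound:
  assumes x: "\<And>t. t \<in> J \<Longrightarrow> \<bar>x t\<bar> \<le> r" and t: "t \<in> J"
    and int: "(\<lambda>s. K t s (x (\<tau> s))) integrable_on {0..\<eta> t}"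
  shows "\<bar>integral_factor x t\<bar> \<le> Q + \<rho> * C"
proof -
  have "\<bar>integral {0..\<eta> t} (\<lambda>s. K t s (x (\<tau> s)))\<bar> \<le> (\<eta> t - 0) * C"
  proof (rule abs_integral_le[OF int])
    fix s assume "s \<in> {0..\<eta> t}"
    then have "s \<in> J" using \<eta>_le[OF t] J by auto
    then show "\<bar>K t s (x (\<tau> s))\<bar> \<le> C"
      using \<tau>(1) by (intro K_bound t x) auto
  qed (use \<eta>_le[OF t] in simp)
  also have "\<dots> \<le> \<rho> * C"
    using \<eta>_le[OF t] C_nonneg by (simp add: mult_right_mono)
  finally show ?thesis
    using q(2)[OF t] by (simp add: integral_factor_def)
qed

lemma product_op_bound:
  assumes x: "\<And>t. t \<in> J \<Longrightarrow> \<bar>x t\<bar> \<le> r" and t: "t \<in> J"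
    and int: "(\<lambda>s. K t s (x (\<tau> s))) integrable_on {0..\<eta> t}"
  shows "\<bar>product_op x t\<bar> \<le> M_F * (Q + \<rho> * C)"
  unfolding product_op_def abs_mult
  using \<sigma>(1) t x M_F_nonneg
  by (intro mult_mono f_bound integral_factor_bound int) auto

lemma K_section_continuous:
  assumes "t \<in> J" and "\<bar>y\<bar> \<le> r"
  shows "continuous_on J (\<lambda>s. K t s y)"
proof -
  have "continuous_on J (Pair t)" by (intro continuous_intros)
  with K_cont[OF assms(2)] have "continuous_on J (\<lambda>s. (\<lambda>(t, s). K t s y) (t, s))"
    by (rule continuous_on_compose2) (use assms(1) in auto)
  then show ?thesis by simp
qed

text \<open>When the bound on the product is \<open>0\<close>, a solution in the ball has to vanish on \<open>J\<close>. Conversely the zero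
  function is a solution, as \<open>K t s 0\<close> is continuous in \<open>s\<close> and therefore integrable.\<close>

lemma ex1_solution_of_zero_bound:
  assumes zero: "M_F * (Q + \<rho> * C) = 0"
  shows "\<exists>!x. x \<in> C_ball J r \<and> solves_integral_eq J f K q \<sigma> \<tau> \<eta> x"
proof -
  have solves: "solves_integral_eq J f K q \<sigma> \<tau> \<eta> x \<longleftrightarrow>
      (\<forall>t\<in>J. (\<lambda>s. K t s (x (\<tau> s))) integrable_on {0..\<eta> t} \<and> x t = 0)"
    if "x \<in> C_ball J r" for x
    using that product_op_bound[of x] zero unfolding mem_C_ball solves_integral_eq_def
    by (auto simp: product_op_def integral_factor_def)
  define z where "z = restrict (\<lambda>_. 0 :: real) J"
  have z: "z t = 0" if "t \<in> J" for t using that by (simp add: z_def)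
  have z_mem: "z \<in> C_ball J r"
    using r_nonneg by (auto simp: z_def mem_C_ball cong: continuous_on_cong)
  have "(\<lambda>s. K t s (z (\<tau> s))) integrable_on {0..\<eta> t}" if "t \<in> J" for t
  proof -
    have sub: "{0..\<eta> t} \<subseteq> J" using \<eta>_le[OF that] J by auto
    have "continuous_on {0..\<eta> t} (\<lambda>s. K t s 0)"
      using K_section_continuous[OF that, of 0] r_nonneg sub continuous_on_subset by fastforce
    then have "(\<lambda>s. K t s 0) integrable_on {0..\<eta> t}" by (simp add: integrable_continuous_real)
    moreover have "K t s 0 = K t s (z (\<tau> s))" if "s \<in> {0..\<eta> t}" for s
      using sub that \<tau>(1) by (subst z) auto
    ultimately show ?thesis by (rule integrable_eq)
  qed
  with z have "solves_integral_eq J f K q \<sigma> \<tau> \<eta> z" by (simp add: solves[OF z_mem])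
  moreover have "x = z" if "x \<in> C_ball J r" "solves_integral_eq J f K q \<sigma> \<tau> \<eta> x" for x
  proof (rule extensionalityI[of _ J])
    show "x \<in> extensional J" using that(1) by (simp add: mem_C_ball)
    show "x t = z t" if "t \<in> J" for t
      using \<open>x \<in> C_ball J r\<close> \<open>solves_integral_eq J f K q \<sigma> \<tau> \<eta> x\<close> that by (simp add: solves z)
  qed (simp add: z_def)
  ultimately show ?thesis using z_mem by blast
qed

end

section \<open>The contractive case\<close>

text \<open>The functions \<open>\<omega>_f\<close> and \<open>\<omega>_K\<close> are moduli of continuity in the last argument, uniform in the others.
  They stand for \<open>\<parallel>\<alpha>\<parallel> * \<phi>\<close> and \<open>\<parallel>\<gamma>\<parallel> * \<psi>\<close>.\<close>

locale contractive_product_integral_equation = product_integral_equation +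
  fixes \<omega>_f \<omega>_K :: "real \<Rightarrow> real"
  assumes \<omega>_f: "mono_on {0..} \<omega>_f" "continuous_on {0..} \<omega>_f" "\<omega>_f 0 = 0"
    and \<omega>_K: "mono_on {0..} \<omega>_K" "continuous_on {0..} \<omega>_K" "\<omega>_K 0 = 0"
    and f_modulus: "\<And>t x y. t \<in> J \<Longrightarrow> \<bar>x\<bar> \<le> r \<Longrightarrow> \<bar>y\<bar> \<le> r \<Longrightarrow>
          \<bar>f t x - f t y\<bar> \<le> \<omega>_f \<bar>x - y\<bar>"
    and K_modulus: "\<And>t s x y. t \<in> J \<Longrightarrow> s \<in> J \<Longrightarrow> \<bar>x\<bar> \<le> r \<Longrightarrow> \<bar>y\<bar> \<le> r \<Longrightarrow>
          \<bar>K t s x - K t s y\<bar> \<le> \<omega>_K \<bar>x - y\<bar>"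
    and self_map: "M_F * (Q + \<rho> * C) \<le> r"
    and contraction: "\<And>t. t > 0 \<Longrightarrow> M_F * \<rho> * \<omega>_K t + (Q + \<rho> * C) * \<omega>_f t < t"
begin

text \<open>Integrability is needed on all of \<open>J\<close>, and not just up to \<open>\<eta> t\<close>, because continuity in \<open>t\<close> compares
  integrands for different \<open>t\<close> on a common interval.\<close>

lemma K_integrable_J:
  assumes x: "continuous_on J x" "\<And>t. t \<in> J \<Longrightarrow> \<bar>x t\<bar> \<le> r" and t: "t \<in> J"
  shows "(\<lambda>s. K t s (x (\<tau> s))) integrable_on {0..\<rho>}"
proof (rule integrable_on_superposition[where h = "K t" and u = "\<lambda>s. x (\<tau> s)" and Y = "{-r..r}"])
  show "continuous_on ({0..\<rho>} \<times> {-r..r}) (\<lambda>(s, y). K t s y)"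
  proof (rule continuous_on_Times_modulus[OF _ \<omega>_K(2,3)])
    fix y assume "y \<in> {-r..r}"
    then show "continuous_on {0..\<rho>} (\<lambda>s. K t s y)"
      using K_section_continuous[OF t, of y] J by auto
  qed (use K_modulus t J in \<open>auto simp: dist_real_def\<close>)
  have "\<tau> \<in> measurable (lebesgue_on J) (restrict_space borel J)"
    using \<tau> by (intro measurable_restrict_space2) auto
  from measurable_compose[OF this borel_measurable_continuous_on_restrict[OF x(1)]]
  show "(\<lambda>s. x (\<tau> s)) \<in> borel_measurable (lebesgue_on {0..\<rho>})" by (simp add: J)
  show "(\<lambda>s. x (\<tau> s)) \<in> {0..\<rho>} \<rightarrow> {-r..r}"
    using x(2) \<tau>(1) by (auto simp: J abs_le_iff Pi_iff minus_le_iff)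
qed simp

lemma K_integrable:
  assumes "continuous_on J x" "\<And>t. t \<in> J \<Longrightarrow> \<bar>x t\<bar> \<le> r" and t: "t \<in> J"
  shows "(\<lambda>s. K t s (x (\<tau> s))) integrable_on {0..\<eta> t}"
  by (rule integrable_on_subinterval[OF K_integrable_J[OF assms]]) (use \<eta>_le[OF t] in auto)

lemma integral_factor_contraction:
  assumes x: "continuous_on J x" "\<And>t. t \<in> J \<Longrightarrow> \<bar>x t\<bar> \<le> r"
    and y: "continuous_on J y" "\<And>t. t \<in> J \<Longrightarrow> \<bar>y t\<bar> \<le> r"
    and D: "\<And>t. t \<in> J \<Longrightarrow> \<bar>x t - y t\<bar> \<le> D" and t: "t \<in> J"
  shows "\<bar>integral_factor x t - integral_factor y t\<bar> \<le> \<rho> * \<omega>_K D"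
proof -
  have "D \<ge> 0" using D[OF t] by simp
  have \<omega>D: "\<omega>_K D \<ge> 0" using mono_onD[OF \<omega>_K(1), of 0 D] \<omega>_K(3) \<open>D \<ge> 0\<close> by simp
  note int = K_integrable[OF x t] K_integrable[OF y t]
  have "\<bar>integral {0..\<eta> t} (\<lambda>s. K t s (x (\<tau> s)) - K t s (y (\<tau> s)))\<bar> \<le> (\<eta> t - 0) * \<omega>_K D"
  proof (rule abs_integral_le)
    fix s assume "s \<in> {0..\<eta> t}"
    then have s: "s \<in> J" "\<tau> s \<in> J" using \<eta>_le[OF t] J \<tau>(1) by auto
    have "\<bar>K t s (x (\<tau> s)) - K t s (y (\<tau> s))\<bar> \<le> \<omega>_K \<bar>x (\<tau> s) - y (\<tau> s)\<bar>"
      using s x y t by (intro K_modulus) auto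
    also have "\<dots> \<le> \<omega>_K D"
      using D[OF s(2)] \<open>D \<ge> 0\<close> by (intro mono_onD[OF \<omega>_K(1)]) auto
    finally show "\<bar>K t s (x (\<tau> s)) - K t s (y (\<tau> s))\<bar> \<le> \<omega>_K D" .
  qed (use int \<eta>_le[OF t] in \<open>auto intro: integrable_diff\<close>)
  also have "\<dots> \<le> \<rho> * \<omega>_K D"
    using \<eta>_le[OF t] \<omega>D by (simp add: mult_right_mono)
  finally show ?thesis
    by (simp add: integral_factor_def integral_diff[OF int])
qed

lemma product_op_continuous:
  assumes x: "continuous_on J x" "\<And>t. t \<in> J \<Longrightarrow> \<bar>x t\<bar> \<le> r"
  shows "continuous_on J (product_op x)"
proof -
  have "continuous_on (J \<times> {-r..r}) (\<lambda>(t, y). f t y)"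
    by (rule continuous_on_Times_modulus[OF _ \<omega>_f(2,3)])
      (use f_cont f_modulus in \<open>auto simp: dist_real_def\<close>)
  moreover have "continuous_on J (\<lambda>t. (t, x (\<sigma> t)))"
    using \<sigma> by (intro continuous_on_Pair continuous_on_id continuous_on_compose2[OF x(1)]) auto
  ultimately have "continuous_on J (\<lambda>t. (\<lambda>(t, y). f t y) (t, x (\<sigma> t)))"
  proof (rule continuous_on_compose2)
    show "(\<lambda>t. (t, x (\<sigma> t))) ` J \<subseteq> J \<times> {-r..r}"
      using \<sigma>(1) x(2) by (auto simp: abs_le_iff Pi_iff minus_le_iff)
  qed
  then have "continuous_on J (\<lambda>t. f t (x (\<sigma> t)))" by simp
  moreover have "continuous_on J (\<lambda>t. integral {0..\<eta> t} (\<lambda>s. K t s (x (\<tau> s))))"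
  proof (rule continuous_on_integral_moving_endpoint[where b = \<rho> and C = C])
    fix s assume "s \<in> {0..\<rho>}"
    then have "s \<in> J" by (simp add: J)
    then have s: "s \<in> J" "\<bar>x (\<tau> s)\<bar> \<le> r" using x(2) \<tau>(1) by auto
    have "continuous_on J (\<lambda>t. (t, s))" by (intro continuous_intros)
    with K_cont[OF s(2)] have "continuous_on J (\<lambda>t. (\<lambda>(t, s'). K t s' (x (\<tau> s))) (t, s))"
      by (rule continuous_on_compose2) (use s(1) in auto)
    then show "continuous_on J (\<lambda>t. K t s (x (\<tau> s)))" by simp
  next
    fix t s assume "t \<in> J" "s \<in> {0..\<rho>}"
    then show "\<bar>K t s (x (\<tau> s))\<bar> \<le> C"
      using \<tau>(1) by (intro K_bound x(2)) (auto simp: J)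
  next
    show "\<eta> \<in> J \<rightarrow> {0..\<rho>}" using \<eta>(1) by (simp add: J)
  qed (rule K_integrable_J[OF x] \<eta>; assumption?)+
  ultimately show ?thesis
    unfolding product_op_def integral_factor_def
    by (intro continuous_on_mult continuous_on_add q(1))
qed

text \<open>Each summand of \<open>F x * (G x - G y) + G y * (F x - F y)\<close> pairs the bound on one factor with the
  modulus of the other.\<close>

lemma product_op_contraction:
  assumes x: "continuous_on J x" "\<And>t. t \<in> J \<Longrightarrow> \<bar>x t\<bar> \<le> r"
    and y: "continuous_on J y" "\<And>t. t \<in> J \<Longrightarrow> \<bar>y t\<bar> \<le> r"
    and D: "\<And>t. t \<in> J \<Longrightarrow> \<bar>x t - y t\<bar> \<le> D" and t: "t \<in> J"
  shows "\<bar>product_op x t - product_op y t\<bar> \<le> M_F * \<rho> * \<omega>_K D + (Q + \<rho> * C) * \<omega>_f D"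
proof -
  have "D \<ge> 0" using D[OF t] by simp
  have \<sigma>t: "\<sigma> t \<in> J" using \<sigma>(1) t by auto
  let ?fx = "f t (x (\<sigma> t))" and ?fy = "f t (y (\<sigma> t))"
  have "\<bar>?fx - ?fy\<bar> \<le> \<omega>_f \<bar>x (\<sigma> t) - y (\<sigma> t)\<bar>"
    using t \<sigma>t x y by (intro f_modulus) auto
  also have "\<dots> \<le> \<omega>_f D"
    using D[OF \<sigma>t] \<open>D \<ge> 0\<close> by (intro mono_onD[OF \<omega>_f(1)]) auto
  finally have df: "\<bar>?fx - ?fy\<bar> \<le> \<omega>_f D" .
  have "product_op x t - product_op y t =
      ?fx * (integral_factor x t - integral_factor y t) + integral_factor y t * (?fx - ?fy)"
    by (simp add: product_op_def algebra_simps)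
  then have "\<bar>product_op x t - product_op y t\<bar>
      \<le> \<bar>?fx\<bar> * \<bar>integral_factor x t - integral_factor y t\<bar> + \<bar>integral_factor y t\<bar> * \<bar>?fx - ?fy\<bar>"
    by (metis abs_mult abs_triangle_ineq)
  also have "\<dots> \<le> M_F * (\<rho> * \<omega>_K D) + (Q + \<rho> * C) * \<omega>_f D"
    using t \<sigma>t x(2) M_F_nonneg Q_nonneg C_nonneg \<rho>_nonneg
    by (intro add_mono mult_mono f_bound integral_factor_contraction integral_factor_bound K_integrable df x y D) auto
  finally show ?thesis by (simp add: mult.assoc)
qed

lemma ex1_solution: "\<exists>!x. x \<in> C_ball J r \<and> solves_integral_eq J f K q \<sigma> \<tau> \<eta> x"
proof -
  let ?\<Phi> = "\<lambda>t. M_F * \<rho> * \<omega>_K t + (Q + \<rho> * C) * \<omega>_f t"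
  have "\<exists>!x. x \<in> C_ball J r \<and> (\<forall>t\<in>J. x t = product_op x t)"
  proof (rule nonlinear_contraction_on_C_ball[OF \<rho>_nonneg J r_nonneg, of ?\<Phi>])
    show "mono_on {0..} ?\<Phi>"
      using M_F_nonneg Q_nonneg C_nonneg \<rho>_nonneg
      by (intro mono_onI add_mono mult_left_mono mono_onD[OF \<omega>_K(1)] mono_onD[OF \<omega>_f(1)]) auto
    show "continuous_on {0..} ?\<Phi>"
      by (intro continuous_intros \<omega>_f \<omega>_K)
  qed (simp_all add: contraction \<omega>_f \<omega>_K product_op_continuous product_op_contraction
      order_trans[OF product_op_bound self_map] K_integrable)
  moreover have "x \<in> C_ball J r \<and> solves_integral_eq J f K q \<sigma> \<tau> \<eta> x \<longleftrightarrow>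
      x \<in> C_ball J r \<and> (\<forall>t\<in>J. x t = product_op x t)" for x
    using K_integrable[of x]
    by (auto simp: mem_C_ball solves_integral_eq_def product_op_def integral_factor_def)
  ultimately show ?thesis by simp
qed

end

section \<open>Existence and uniqueness\<close>

theorem theorem5p1:
  fixes \<rho> r M_F M_G :: real
    and J :: "real set"
    and \<sigma> \<tau> \<eta> q \<alpha> \<phi> \<psi> :: "real \<Rightarrow> real"
    and \<gamma> f :: "real \<Rightarrow> real \<Rightarrow> real"
    and K :: "real \<Rightarrow> real \<Rightarrow> real \<Rightarrow> real"
  assumes "\<rho> > 0"
    and "J = {0..\<rho>}"
    and "\<sigma> \<in> J \<rightarrow> J" and "\<tau> \<in> J \<rightarrow> J" and "\<eta> \<in> J \<rightarrow> J"
    and "continuous_on J \<sigma>" and "continuous_on J \<eta>"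
    and "\<tau> \<in> borel_measurable (lebesgue_on J)"
    and "continuous_on J q"
    and "\<And>x. continuous_on J (\<lambda>t. f t x)"
    and "\<And>x. continuous_on (J \<times> J) (\<lambda>(t, s). K t s x)"
    and "\<And>t. t \<in> J \<Longrightarrow> \<alpha> t \<ge> 0" and "bounded (\<alpha> ` J)"
    and "\<And>t s. t \<in> J \<Longrightarrow> s \<in> J \<Longrightarrow> \<gamma> t s \<ge> 0"
    and "bounded ((\<lambda>(t, s). \<gamma> t s) ` (J \<times> J))"
    and "r > 0"
    and "\<phi> \<in> {0..} \<rightarrow> {0..}" and "mono_on {0..} \<phi>" and "continuous_on {0..} \<phi>"
    and "\<psi> \<in> {0..} \<rightarrow> {0..}" and "mono_on {0..} \<psi>" and "continuous_on {0..} \<psi>"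
    and "\<And>t x y. t \<in> J \<Longrightarrow> \<bar>x\<bar> \<le> r \<Longrightarrow> \<bar>y\<bar> \<le> r \<Longrightarrow>
           \<bar>f t x - f t y\<bar> \<le> \<alpha> t * \<phi> \<bar>x - y\<bar>"
    and "\<And>t s x y. t \<in> J \<Longrightarrow> s \<in> J \<Longrightarrow> \<bar>x\<bar> \<le> r \<Longrightarrow> \<bar>y\<bar> \<le> r \<Longrightarrow>
           \<bar>K t s x - K t s y\<bar> \<le> \<gamma> t s * \<psi> \<bar>x - y\<bar>"
    and "M_F = sup_norm_on J \<alpha> * \<phi> r + sup_norm_on J (\<lambda>t. f t 0)"
    and "M_G = sup_norm_on J q + \<rho> * (sup_norm_on (J \<times> J) (\<lambda>(t, s). K t s 0)
           + sup_norm_on (J \<times> J) (\<lambda>(t, s). \<gamma> t s) * \<psi> r)"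
    and "\<And>t. t > 0 \<Longrightarrow> M_F * \<rho> * sup_norm_on (J \<times> J) (\<lambda>(t, s). \<gamma> t s) * \<psi> t
           + M_G * sup_norm_on J \<alpha> * \<phi> t < t"
    and "M_F * M_G \<le> r"
  shows "\<exists>!x. x \<in> C_ball J r \<and> solves_integral_eq J f K q \<sigma> \<tau> \<eta> x"
proof -
  note J = \<open>J = {0..\<rho>}\<close> and \<rho> = \<open>\<rho> > 0\<close> and r = \<open>r > 0\<close>
  define A where "A = sup_norm_on J \<alpha>"
  define \<Gamma> where "\<Gamma> = sup_norm_on (J \<times> J) (\<lambda>(t, s). \<gamma> t s)"
  define C where "C = sup_norm_on (J \<times> J) (\<lambda>(t, s). K t s 0) + \<Gamma> * \<psi> r"
  define Q where "Q = sup_norm_on J q"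
  have M_F: "M_F = A * \<phi> r + sup_norm_on J (\<lambda>t. f t 0)"
    and M_G: "M_G = Q + \<rho> * C"
    using assms(25,26) by (simp_all add: A_def \<Gamma>_def C_def Q_def)
  have contraction: "M_F * \<rho> * (\<Gamma> * \<psi> t) + M_G * (A * \<phi> t) < t" if "t > 0" for t
    using assms(27)[OF that] by (simp add: A_def \<Gamma>_def mult.assoc)
  have "compact J" "0 \<in> J" using J \<rho> by auto
  note [simp] = \<open>0 \<in> J\<close>
  have bounded_image: "bounded (g ` S)" if "continuous_on S g" "compact S" for g :: "'z::topological_space \<Rightarrow> real" and S
    using that by (intro compact_imp_bounded compact_continuous_image)
  have \<alpha>: "\<alpha> t \<le> A" if "t \<in> J" for t
    using abs_le_sup_norm_on[OF assms(13) that] by (simp add: A_def)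
  have \<gamma>: "\<gamma> t s \<le> \<Gamma>" if "t \<in> J" "s \<in> J" for t s
    using abs_le_sup_norm_on[OF assms(15), of "(t, s)"] that by (simp add: \<Gamma>_def)
  have A: "A \<ge> 0" using \<alpha>[of 0] assms(12)[of 0] by simp
  have \<Gamma>: "\<Gamma> \<ge> 0" using \<gamma>[of 0 0] assms(14)[of 0 0] by simp
  have q: "\<bar>q t\<bar> \<le> Q" if "t \<in> J" for t
    unfolding Q_def by (intro abs_le_sup_norm_on bounded_image assms that \<open>compact J\<close>)
  have f0: "\<bar>f t 0\<bar> \<le> sup_norm_on J (\<lambda>t. f t 0)" if "t \<in> J" for t
    by (intro abs_le_sup_norm_on[of "\<lambda>t. f t 0"] bounded_image assms that \<open>compact J\<close>)
  have K0: "\<bar>K t s 0\<bar> \<le> sup_norm_on (J \<times> J) (\<lambda>(t, s). K t s 0)" if "t \<in> J" "s \<in> J" for t s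
    using abs_le_sup_norm_on[OF bounded_image[OF assms(11)[of 0]], of "(t, s)"] that \<open>compact J\<close>
    by (simp add: compact_Times)
  have \<phi>: "\<phi> u \<ge> 0" and \<psi>: "\<psi> u \<ge> 0" if "u \<ge> 0" for u
    using assms(17,20) that by auto
  have \<phi>_mono: "\<phi> u \<le> \<phi> v" and \<psi>_mono: "\<psi> u \<le> \<psi> v" if "0 \<le> u" "u \<le> v" for u v
    using assms(18,21) that by (auto simp: mono_on_def)
  have f_modulus: "\<bar>f t x - f t y\<bar> \<le> A * \<phi> \<bar>x - y\<bar>" if "t \<in> J" "\<bar>x\<bar> \<le> r" "\<bar>y\<bar> \<le> r" for t x y
    using assms(23)[OF that] mult_right_mono[OF \<alpha>[OF that(1)] \<phi>[of "\<bar>x - y\<bar>"]] by simp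
  have K_modulus: "\<bar>K t s x - K t s y\<bar> \<le> \<Gamma> * \<psi> \<bar>x - y\<bar>"
    if "t \<in> J" "s \<in> J" "\<bar>x\<bar> \<le> r" "\<bar>y\<bar> \<le> r" for t s x y
    using assms(24)[OF that] mult_right_mono[OF \<gamma>[OF that(1,2)] \<psi>[of "\<bar>x - y\<bar>"]] by simp
  have f_bound: "\<bar>f t x\<bar> \<le> M_F" if "t \<in> J" "\<bar>x\<bar> \<le> r" for t x
    using f_modulus[of t x 0] f0[of t] mult_left_mono[OF \<phi>_mono[of "\<bar>x\<bar>" r] A] that r
    by (simp add: M_F)
  have K_bound: "\<bar>K t s x\<bar> \<le> C" if "t \<in> J" "s \<in> J" "\<bar>x\<bar> \<le> r" for t s x
    using K_modulus[of t s x 0] K0[of t s] mult_left_mono[OF \<psi>_mono[of "\<bar>x\<bar>" r] \<Gamma>] that r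
    by (simp add: C_def)
  have "M_F \<ge> 0" using f_bound[of 0 0] r by simp
  have "C \<ge> 0" using K_bound[of 0 0 0] r by simp
  have "M_G \<ge> 0" using \<open>C \<ge> 0\<close> q[of 0] \<rho> by (simp add: M_G)
  interpret product_integral_equation \<rho> r M_F Q C J \<sigma> \<tau> \<eta> q f K
    by unfold_locales (use assms(3-11) J \<rho> r q f_bound K_bound in simp_all)
  show ?thesis
  proof (cases "M_F * M_G = 0")
    case True
    then show ?thesis by (intro ex1_solution_of_zero_bound) (simp add: M_G)
  next
    case False
    then have pos: "M_F > 0" "M_G > 0" using \<open>M_F \<ge> 0\<close> \<open>M_G \<ge> 0\<close> by auto
    \<comment> \<open>By monotonicity the value at \<open>0\<close> of the comparison function is at most its value at \<open>e\<close>, which is below \<open>e\<close>.\<close>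
    have small: "M_F * \<rho> * (\<Gamma> * \<psi> 0) + M_G * (A * \<phi> 0) \<le> 0"
    proof (rule field_le_epsilon)
      fix e :: real assume "e > 0"
      have "M_F * \<rho> * (\<Gamma> * \<psi> 0) + M_G * (A * \<phi> 0) \<le> M_F * \<rho> * (\<Gamma> * \<psi> e) + M_G * (A * \<phi> e)"
        using pos \<rho> A \<Gamma> \<open>e > 0\<close> by (intro add_mono mult_left_mono \<phi>_mono \<psi>_mono) auto
      with contraction[OF \<open>e > 0\<close>]
      show "M_F * \<rho> * (\<Gamma> * \<psi> 0) + M_G * (A * \<phi> 0) \<le> 0 + e" by simp
    qed
    have nonneg: "A * \<phi> 0 \<ge> 0" "\<Gamma> * \<psi> 0 \<ge> 0" using A \<Gamma> \<phi> \<psi> by simp_all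
    have "M_F * \<rho> > 0" using pos \<rho> by simp
    with small nonneg have "M_F * \<rho> * (\<Gamma> * \<psi> 0) = 0" "M_G * (A * \<phi> 0) = 0"
      using mult_nonneg_nonneg[of "M_F * \<rho>" "\<Gamma> * \<psi> 0"] mult_nonneg_nonneg[of M_G "A * \<phi> 0"] pos
      by linarith+
    with pos \<rho> have moduli_zero: "\<Gamma> * \<psi> 0 = 0" "A * \<phi> 0 = 0" by auto
    interpret contractive_product_integral_equation \<rho> r M_F Q C J \<sigma> \<tau> \<eta> q f K
      "\<lambda>u. A * \<phi> u" "\<lambda>u. \<Gamma> * \<psi> u"
    proof
      show "mono_on {0..} (\<lambda>u. A * \<phi> u)" "mono_on {0..} (\<lambda>u. \<Gamma> * \<psi> u)"
        using A \<Gamma> by (auto intro!: mono_onI mult_left_mono \<phi>_mono \<psi>_mono)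
      show "continuous_on {0..} (\<lambda>u. A * \<phi> u)" "continuous_on {0..} (\<lambda>u. \<Gamma> * \<psi> u)"
        using assms(19,22) by (auto intro: continuous_on_mult_left)
      show "M_F * (Q + \<rho> * C) \<le> r" using assms(28) by (simp add: M_G)
      show "M_F * \<rho> * (\<Gamma> * \<psi> t) + (Q + \<rho> * C) * (A * \<phi> t) < t" if "t > 0" for t
        using contraction[OF that] by (simp add: M_G)
    qed (use f_modulus K_modulus moduli_zero in simp_all)
    show ?thesis by (rule ex1_solution)
  qed
qed

end
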